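(* Let $N\ge1$, let $\mathcal{X}\subset\mathbb{R}^n$, let $\psi(\cdot,\xi_i)$, $i=1,\dots,N$, be real-valued and differentiable, and let $\tilde\phi$ be a smoothing function of $\phi:\mathbb{R}\to\mathbb{R}$. Suppose that: (1) the mini-batch $B$ is sampled uniformly at random from $\{1,2,\dots,N\}$, with each index equally likely to be selected, without replacement; (2) there is $G_1>0$ with $\mathbb{E}[\|\nabla_x\psi(x,\xi_i)\|^2]\le G_1^2$ for all $x\in\mathcal{X}$ and each $i\in\{1,\dots,N\}$; (3) there is $G_2>0$ with $\mathbb{E}[\tilde\phi'(\psi(x,\xi_i),\mu)^2]\le\left(\frac{G_2}{\mu}\right)^2$ for all $x\in\mathcal{X}$, all $\mu>0$ and each $i\in\{1,\dots,N\}$; (4) for each $i$, $\psi(x,\xi_i)$ is sampled independently from $\nabla_x\psi(x,\xi_i)$ (i.e. these are independent random variables). Then the stochastic batch smoothing gradient $$\tilde g(x,\mu)=\frac1{|B|}\sum_{i\in B}\tilde\phi'(\psi(x,\xi_i),\mu)\nabla_x\psi(x,\xi_i)$$ satisfies, for all $x\in\mathcal{X}$ and $\mu>0$, $$\mathbb{E}[\|\tilde g(x,\mu)\|^2]\le\left(\frac{G_1G_2}{\mu}\right)^2.$$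
   Context: The finite-sum compositional objective is $f(x)=\frac1N\sum_{i=1}^N\phi(\psi(x,\xi_i))$, where $\xi_i$ is the $i$-th (random) data sample and $\phi:\mathbb{R}\to\mathbb{R}$ is locally Lipschitz and possibly non-smooth. A smoothing function of $\phi$ is a function $\tilde\phi:\mathbb{R}\times[0,+\infty)\to\mathbb{R}$ such that $\tilde\phi(\cdot,\mu)$ is continuously differentiable for each $\mu>0$ and $\lim_{z\to t,\,\mu\downarrow0}\tilde\phi(z,\mu)=\phi(t)$ for all $t$; $\tilde\phi'(\cdot,\mu)$ is the derivative of $\tilde\phi(\cdot,\mu)$. The batch size $|B|\ge1$ is fixed, the batch is drawn independently of the data samples, and the expectation is over both the data samples and the batch. *)

theory Defs
  imports "HOL-Probability.Probability"
begin

definition locally_lipschitz :: "(real \<Rightarrow> real) \<Rightarrow> bool" where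
  "locally_lipschitz \<phi> \<longleftrightarrow> (\<forall>t. \<exists>r>0. \<exists>L. lipschitz_on L (ball t r) \<phi>)"

text \<open>
  A smoothing function is only meaningful for a second argument \<open>\<mu> \<ge> 0\<close>; its values for
  \<open>\<mu> < 0\<close> are never used. In the joint limit \<open>z \<rightarrow> t\<close>, \<open>\<mu> \<down> 0\<close> the value \<open>z = t\<close> is allowed,
  whence \<open>nhds t\<close> rather than \<open>at t\<close>.
\<close>
definition smoothing_function :: "(real \<Rightarrow> real \<Rightarrow> real) \<Rightarrow> (real \<Rightarrow> real) \<Rightarrow> bool" where
  "smoothing_function \<phi>t \<phi> \<longleftrightarrow>
     (\<forall>\<mu>>0. (\<lambda>z. \<phi>t z \<mu>) C1_differentiable_on UNIV) \<and>
     (\<forall>t. ((\<lambda>(z, \<mu>). \<phi>t z \<mu>) \<longlongrightarrow> \<phi> t) (nhds t \<times>\<^sub>F at_right 0))"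

definition grad :: "('a::real_inner \<Rightarrow> real) \<Rightarrow> 'a \<Rightarrow> 'a" where
  "grad f x = (THE D. GDERIV f x :> D)"

text \<open>
  The library's \<open>prob_space.indep_var\<close> forces both random variables to have the same type; this is
  the same notion for two possibly different types.
\<close>
definition indep_rv ::
  "'w measure \<Rightarrow> 'a measure \<Rightarrow> ('w \<Rightarrow> 'a) \<Rightarrow> 'b measure \<Rightarrow> ('w \<Rightarrow> 'b) \<Rightarrow> bool" where
  "indep_rv M S X T Y \<longleftrightarrow>
     X \<in> measurable M S \<and> Y \<in> measurable M T \<and>
     prob_space.indep_set M
       {X -` A \<inter> space M | A. A \<in> sets S} {Y -` A \<inter> space M | A. A \<in> sets T}"

lemma (in prob_space) indep_rv_iff_indep_var: "indep_rv M S X T Y \<longleftrightarrow> indep_var S X T Y"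
proof -
  have *: "sigma_sets (space M) {Z -` A \<inter> space M | A. A \<in> sets U} = {Z -` A \<inter> space M | A. A \<in> sets U}"
    if "Z \<in> measurable M U" for Z :: "'a \<Rightarrow> 'c" and U
    using sets_vimage_algebra[of "space M" Z U] sets_vimage_algebra2[of Z "space M" U] measurable_space[OF that] by auto
  show ?thesis
    unfolding indep_rv_def indep_var_eq by (auto simp: *)
qed

definition batches :: "nat \<Rightarrow> nat \<Rightarrow> nat set set" where
  "batches N b = {A. A \<subseteq> {1..N} \<and> card A = b}"

text \<open>
  Uniform sampling of \<open>b\<close> indices without replacement: all \<open>b\<close>-element subsets of \<open>{1..N}\<close> are
  equally likely.
\<close>
definition uniform_batch :: "'w measure \<Rightarrow> nat \<Rightarrow> nat \<Rightarrow> ('w \<Rightarrow> nat set) \<Rightarrow> bool" where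
  "uniform_batch M N b B \<longleftrightarrow>
     B \<in> measurable M (count_space (batches N b)) \<and>
     distr M (count_space (batches N b)) B = uniform_count_measure (batches N b)"

definition batch_smoothing_gradient ::
  "(real \<Rightarrow> real \<Rightarrow> real) \<Rightarrow> ('a::real_inner \<Rightarrow> 's \<Rightarrow> real) \<Rightarrow> nat set \<Rightarrow> (nat \<Rightarrow> 's) \<Rightarrow> 'a \<Rightarrow> real \<Rightarrow> 'a"
where
  "batch_smoothing_gradient \<phi>t \<psi> B s x \<mu> =
     (1 / real (card B)) *\<^sub>R
       (\<Sum>i\<in>B. deriv (\<lambda>z. \<phi>t z \<mu>) (\<psi> x (s i)) *\<^sub>R grad (\<lambda>y. \<psi> y (s i)) x)"

end

theory Submission
  imports Defs
begin

text \<open>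
  By the Cauchy--Schwarz inequality, the squared norm of a batch average of vectors \<open>V\<^sub>i\<close> is at most
  the batch average of the \<open>\<parallel>V\<^sub>i\<parallel>\<^sup>2\<close>. As the batch is independent of the data, the expectation of
  the latter is \<open>(1/b) \<Sum>\<^sub>i P(i \<in> B) E\<parallel>V\<^sub>i\<parallel>\<^sup>2\<close>, and the inclusion probabilities sum to \<open>b\<close>
  since every batch has exactly \<open>b\<close> elements. Finally \<open>E\<parallel>V\<^sub>i\<parallel>\<^sup>2\<close> factorises by hypothesis (4).
\<close>

lemma indep_rv_compose:
  assumes "prob_space M" "indep_rv M S X T Y" "f \<in> measurable S U" "g \<in> measurable T V"
  shows "indep_rv M U (\<lambda>\<omega>. f (X \<omega>)) V (\<lambda>\<omega>. g (Y \<omega>))"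
proof -
  interpret prob_space M by fact
  have X[measurable]: "X \<in> measurable M S" and Y[measurable]: "Y \<in> measurable M T"
    and ind: "indep_set {X -` A \<inter> space M | A. A \<in> sets S} {Y -` A \<inter> space M | A. A \<in> sets T}"
    using assms(2) by (auto simp: indep_rv_def)
  have sub: "\<exists>A'. (\<lambda>\<omega>. h (Z \<omega>)) -` A \<inter> space M = Z -` A' \<inter> space M \<and> A' \<in> sets R"
    if "Z \<in> measurable M R" "h \<in> measurable R W" "A \<in> sets W"
    for A and Z :: "_ \<Rightarrow> 'z" and h :: "'z \<Rightarrow> 'w" and R W
    using that by (intro exI[of _ "h -` A \<inter> space R"]) (auto dest: measurable_space measurable_sets)
  have "indep_set {(\<lambda>\<omega>. f (X \<omega>)) -` A \<inter> space M | A. A \<in> sets U}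
      {(\<lambda>\<omega>. g (Y \<omega>)) -` A \<inter> space M | A. A \<in> sets V}"
  proof -
    have "{(\<lambda>\<omega>. f (X \<omega>)) -` A \<inter> space M | A. A \<in> sets U} \<subseteq> {X -` A \<inter> space M | A. A \<in> sets S}"
      using sub[OF X assms(3)] by blast
    moreover have "{(\<lambda>\<omega>. g (Y \<omega>)) -` A \<inter> space M | A. A \<in> sets V} \<subseteq> {Y -` A \<inter> space M | A. A \<in> sets T}"
      using sub[OF Y assms(4)] by blast
    ultimately show ?thesis
      using ind unfolding indep_sets2_eq by (meson subset_iff)
  qed
  moreover have "(\<lambda>\<omega>. f (X \<omega>)) \<in> measurable M U" "(\<lambda>\<omega>. g (Y \<omega>)) \<in> measurable M V"
    using assms(3,4) by measurable
  ultimately show ?thesis by (simp add: indep_rv_def)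
qed

text \<open>Only values on \<open>space M\<close> enter the events. This allows the gradient to be
  exchanged for a measurable function of the sample that agrees with it merely at outcomes in
  \<open>space M\<close>.\<close>

lemma indep_rv_cong:
  assumes "\<And>\<omega>. \<omega> \<in> space M \<Longrightarrow> X \<omega> = X' \<omega>" "\<And>\<omega>. \<omega> \<in> space M \<Longrightarrow> Y \<omega> = Y' \<omega>"
  shows "indep_rv M S X T Y \<longleftrightarrow> indep_rv M S X' T Y'"
proof -
  have "X -` A \<inter> space M = X' -` A \<inter> space M" "Y -` C \<inter> space M = Y' -` C \<inter> space M" for A C
    using assms by auto
  moreover have "X \<in> measurable M S \<longleftrightarrow> X' \<in> measurable M S" "Y \<in> measurable M T \<longleftrightarrow> Y' \<in> measurable M T"
    using assms by (simp_all cong: measurable_cong)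
  ultimately show ?thesis by (simp add: indep_rv_def)
qed

text \<open>\<open>grad\<close> is a definite description, so both existence and uniqueness are
  needed: the derivative is represented by a vector (Riesz), and two representing vectors have equal
  inner products with every vector.\<close>

lemma gderiv_grad:
  fixes f :: "'a::euclidean_space \<Rightarrow> real"
  assumes "f differentiable (at x)"
  shows "GDERIV f x :> grad f x"
proof -
  obtain f' where f': "(f has_derivative f') (at x)"
    using assms by (auto simp: differentiable_def)
  interpret linear f' using f' by (rule has_derivative_linear)
  \<comment> \<open>The coordinates of the representing vector are the values of \<open>f'\<close>
    on the basis.\<close>
  let ?D = "\<Sum>b\<in>Basis. f' b *\<^sub>R b"
  have "f' = (\<lambda>h. inner h ?D)"
  proof
    fix h
    have "f' h = f' (\<Sum>b\<in>Basis. inner h b *\<^sub>R b)" by (simp add: euclidean_representation)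
    also have "\<dots> = inner h ?D" by (simp add: sum scaleR inner_sum_right mult.commute)
    finally show "f' h = inner h ?D" .
  qed
  with f' have D: "GDERIV f x :> ?D" unfolding gderiv_def by (rule has_derivative_eq_rhs)
  moreover have "D = ?D" if "GDERIV f x :> D" for D
  proof -
    have "(\<lambda>h. inner h D) = (\<lambda>h. inner h ?D)"
      by (rule has_derivative_unique[OF that[unfolded gderiv_def] D[unfolded gderiv_def]])
    then show ?thesis by (simp only: fun_eq_iff vector_eq_ldot)
  qed
  ultimately show ?thesis unfolding grad_def by (rule theI[where P = "\<lambda>D. GDERIV f x :> D"])
qed

text \<open>This is the directional derivative along \<open>e\<close>, by the chain rule for t
  \<mapsto> \<open>f (x + t *\<^sub>R e)\<close>. The steps form a sequence because limits of
  sequences preserve measurability.\<close>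

lemma difference_quotient_tendsto_inner_grad:
  fixes f :: "'a::euclidean_space \<Rightarrow> real"
  assumes "f differentiable (at x)"
  shows "(\<lambda>k. (f (x + (1 / real (Suc k)) *\<^sub>R e) - f x) * real (Suc k)) \<longlonglongrightarrow> inner (grad f x) e"
proof -
  have 1: "((\<lambda>t. x + t *\<^sub>R e) has_derivative (\<lambda>t. t *\<^sub>R e)) (at 0)"
    by (auto intro!: derivative_eq_intros)
  have 2: "(f has_derivative (\<lambda>h. inner h (grad f x))) (at (x + 0 *\<^sub>R e))"
    using gderiv_grad[OF assms] by (simp add: gderiv_def)
  have "((\<lambda>t. f (x + t *\<^sub>R e)) has_derivative (\<lambda>t. inner (t *\<^sub>R e) (grad f x))) (at 0)"
    by (rule has_derivative_compose[OF 1 2])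
  moreover have "(\<lambda>t. inner (t *\<^sub>R e) (grad f x)) = (*) (inner (grad f x) e)"
    by (auto simp: inner_commute)
  ultimately have "DERIV (\<lambda>t. f (x + t *\<^sub>R e)) 0 :> inner (grad f x) e"
    by (simp add: has_field_derivative_def)
  then have lim: "((\<lambda>h. (f (x + h *\<^sub>R e) - f x) / h) \<longlongrightarrow> inner (grad f x) e) (at 0)"
    by (simp add: DERIV_def)
  \<comment> \<open>\<open>Suc k\<close> keeps the steps well defined and nonzero, as the filter
    \<open>at 0\<close> demands.\<close>
  have "filterlim (\<lambda>k. 1 / real (Suc k)) (at 0) sequentially"
    using LIMSEQ_inverse_real_of_nat by (auto simp: filterlim_at inverse_eq_divide)
  from filterlim_compose[OF lim this] show ?thesis by simp
qed

text \<open>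
  Hypothesis (4) only makes the gradient a random variable, while transferring the independence of
  the batch from the samples requires it to be a measurable function of the sample. This is obtained
  from limits of difference quotients, with junk values at samples where \<open>\<psi>\<close> is not differentiable.
\<close>
lemma grad_factors_measurably:
  fixes \<psi> :: "'a::euclidean_space \<Rightarrow> 's \<Rightarrow> real"
  assumes [measurable]: "\<And>y. \<psi> y \<in> borel_measurable S"
  obtains G where "G \<in> borel_measurable S"
    and "\<And>s. (\<lambda>y. \<psi> y s) differentiable (at x) \<Longrightarrow> grad (\<lambda>y. \<psi> y s) x = G s"
proof
  let ?G = "\<lambda>s. \<Sum>e\<in>Basis.
    lim (\<lambda>k. (\<psi> (x + (1 / real (Suc k)) *\<^sub>R e) s - \<psi> x s) * real (Suc k)) *\<^sub>R e"
  show "?G \<in> borel_measurable S" by measurable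
  show "grad (\<lambda>y. \<psi> y s) x = ?G s" if "(\<lambda>y. \<psi> y s) differentiable (at x)" for s
    using limI[OF difference_quotient_tendsto_inner_grad[OF that]]
    by (simp add: euclidean_representation)
qed

text \<open>Under the C1 hypothesis \<open>deriv f\<close> is the continuous derivative itself, and
  continuous functions are Borel.\<close>

lemma borel_measurable_deriv_C1:
  fixes f :: "real \<Rightarrow> real"
  assumes "f C1_differentiable_on UNIV"
  shows "deriv f \<in> borel_measurable borel"
proof -
  obtain D where D: "\<And>x. (f has_vector_derivative D x) (at x)" and cont: "continuous_on UNIV D"
    using assms by (auto simp: C1_differentiable_on_def)
  have "deriv f = D"
    using D by (auto simp: has_real_derivative_iff_has_vector_derivative intro!: DERIV_imp_deriv)
  with cont show ?thesis by (simp add: borel_measurable_continuous_onI)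
qed

text \<open>Triangle inequality, then Cauchy-Schwarz against the constant 1. If
  \<open>card A = 0\<close>, both sides vanish because \<open>1 / 0 = 0\<close>.\<close>

lemma norm_average_squared_le:
  fixes v :: "'i \<Rightarrow> 'a::real_normed_vector"
  shows "(norm ((1 / real (card A)) *\<^sub>R (\<Sum>i\<in>A. v i)))\<^sup>2 \<le> (1 / real (card A)) * (\<Sum>i\<in>A. (norm (v i))\<^sup>2)"
proof (cases "card A = 0")
  case False
  have "(norm (\<Sum>i\<in>A. v i))\<^sup>2 \<le> (\<Sum>i\<in>A. norm (v i))\<^sup>2"
    by (intro power_mono norm_sum) auto
  also have "\<dots> \<le> (\<Sum>i\<in>A. (norm (v i))\<^sup>2) * real (card A)"
    by (rule sum_squared_le_sum_of_squares)
  finally show ?thesis using False by (simp add: power_divide field_simps power2_eq_square)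
qed simp

text \<open>Independence is required index by index, between the event that \<open>i\<close> is
  drawn and the size of \<open>V i\<close>. Once the average is dominated by a weighted sum of
  squared norms, no product of different \<open>V i\<close> occurs.\<close>

lemma (in prob_space) batch_average_second_moment:
  fixes V :: "nat \<Rightarrow> 'a \<Rightarrow> 'b::euclidean_space" and B :: "'a \<Rightarrow> nat set"
  assumes b: "1 \<le> b"
    and B[measurable]: "B \<in> measurable M (count_space (batches N b))"
    and V: "\<And>i. i \<in> {1..N} \<Longrightarrow> V i \<in> borel_measurable M"
    and int: "\<And>i. i \<in> {1..N} \<Longrightarrow> integrable M (\<lambda>\<omega>. (norm (V i \<omega>))\<^sup>2)"
    and bound: "\<And>i. i \<in> {1..N} \<Longrightarrow> expectation (\<lambda>\<omega>. (norm (V i \<omega>))\<^sup>2) \<le> C"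
    and ind: "\<And>i. i \<in> {1..N} \<Longrightarrow>
      indep_var borel (\<lambda>\<omega>. of_bool (i \<in> B \<omega>) :: real) borel (\<lambda>\<omega>. (norm (V i \<omega>))\<^sup>2)"
  defines "avg \<equiv> \<lambda>\<omega>. (1 / real (card (B \<omega>))) *\<^sub>R (\<Sum>i\<in>B \<omega>. V i \<omega>)"
  shows "integrable M (\<lambda>\<omega>. (norm (avg \<omega>))\<^sup>2)"
    and "expectation (\<lambda>\<omega>. (norm (avg \<omega>))\<^sup>2) \<le> C"
proof -
  have B_sub: "B \<omega> \<subseteq> {1..N}" and B_card: "card (B \<omega>) = b" if "\<omega> \<in> space M" for \<omega>
    using measurable_space[OF B that] by (auto simp: batches_def)
  \<comment> \<open>A sum over the random index set becomes a sum over a fixed set with random 0-1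
    weights, so linearity of the expectation applies.\<close>
  have sum_B: "(\<Sum>i\<in>B \<omega>. f i) = (\<Sum>i\<in>{1..N}. of_bool (i \<in> B \<omega>) *\<^sub>R f i)"
    if "\<omega> \<in> space M" for \<omega> and f :: "nat \<Rightarrow> 'c::real_vector"
    using B_sub[OF that] by (intro sum.mono_neutral_cong_left) auto
  have ind_meas: "(\<lambda>\<omega>. of_bool (i \<in> B \<omega>) :: real) \<in> borel_measurable M" for i
    by (rule measurable_compose[OF B]) simp
  have ind_int: "integrable M (\<lambda>\<omega>. of_bool (i \<in> B \<omega>) :: real)" for i
    by (rule integrable_const_bound[of _ 1]) (use ind_meas in auto)
  let ?Z = "\<lambda>\<omega>. \<Sum>i\<in>{1..N}. of_bool (i \<in> B \<omega>) * (norm (V i \<omega>))\<^sup>2"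
  \<comment> \<open>With fixed indices measurability is immediate; it transfers to
    \<open>avg\<close> because the two functions agree on \<open>space M\<close>.\<close>
  have avg_meas: "(\<lambda>\<omega>. (norm (avg \<omega>))\<^sup>2) \<in> borel_measurable M"
  proof -
    have "(\<lambda>\<omega>. (norm ((1 / real b) *\<^sub>R (\<Sum>i\<in>{1..N}. of_bool (i \<in> B \<omega>) *\<^sub>R V i \<omega>)))\<^sup>2)
        \<in> borel_measurable M"
      using V ind_meas by measurable
    then show ?thesis
      by (rule measurable_cong[THEN iffD1, rotated]) (simp add: avg_def B_card sum_B)
  qed
  have le: "(norm (avg \<omega>))\<^sup>2 \<le> (1 / real b) * ?Z \<omega>" if "\<omega> \<in> space M" for \<omega>
    using norm_average_squared_le[of "B \<omega>" "\<lambda>i. V i \<omega>"]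
    by (simp add: avg_def B_card[OF that] sum_B[OF that, of "\<lambda>i. (norm (V i \<omega>))\<^sup>2"])
  have prod_int: "integrable M (\<lambda>\<omega>. of_bool (i \<in> B \<omega>) * (norm (V i \<omega>))\<^sup>2)" if "i \<in> {1..N}" for i
    by (rule indep_var_integrable[OF ind[OF that] ind_int int[OF that]])
  then have Z_int: "integrable M (\<lambda>\<omega>. (1 / real b) * ?Z \<omega>)"
    by (intro integrable_mult_right Bochner_Integration.integrable_sum)
  show int_avg: "integrable M (\<lambda>\<omega>. (norm (avg \<omega>))\<^sup>2)"
    by (rule Bochner_Integration.integrable_bound[OF Z_int avg_meas], rule AE_I2)
       (simp only: real_norm_def abs_power2 order_trans[OF le abs_ge_self])
  have "expectation (\<lambda>\<omega>. (norm (avg \<omega>))\<^sup>2) \<le> expectation (\<lambda>\<omega>. (1 / real b) * ?Z \<omega>)"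
    by (rule integral_mono[OF int_avg Z_int le])
  also have "\<dots> = (1 / real b) * (\<Sum>i\<in>{1..N}. expectation (\<lambda>\<omega>. of_bool (i \<in> B \<omega>) * (norm (V i \<omega>))\<^sup>2))"
    by (subst integral_mult_right_zero, subst Bochner_Integration.integral_sum) (auto intro: prod_int)
  \<comment> \<open>Each inclusion indicator is independent of its own squared norm, so the
    expectation of the product factorises.\<close>
  also have "\<dots> = (1 / real b) * (\<Sum>i\<in>{1..N}.
      expectation (\<lambda>\<omega>. of_bool (i \<in> B \<omega>)) * expectation (\<lambda>\<omega>. (norm (V i \<omega>))\<^sup>2))"
    by (intro arg_cong2[where f = "(*)"] refl sum.cong indep_var_lebesgue_integral ind ind_int int)
  also have "\<dots> \<le> (1 / real b) * (\<Sum>i\<in>{1..N}. expectation (\<lambda>\<omega>. of_bool (i \<in> B \<omega>)) * C)"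
    by (intro mult_left_mono sum_mono bound) auto
  also have "(\<Sum>i\<in>{1..N}. expectation (\<lambda>\<omega>. of_bool (i \<in> B \<omega>)) * C) =
      expectation (\<lambda>\<omega>. \<Sum>i\<in>{1..N}. of_bool (i \<in> B \<omega>)) * C"
    by (subst Bochner_Integration.integral_sum) (use ind_int in \<open>auto simp: sum_distrib_right\<close>)
  \<comment> \<open>At each outcome the indicators add up to the batch size \<open>b\<close>, which
    then cancels against \<open>1 / real b\<close> since \<open>b\<close> is positive.\<close>
  also have "expectation (\<lambda>\<omega>. \<Sum>i\<in>{1..N}. of_bool (i \<in> B \<omega>) :: real) = expectation (\<lambda>_. real b)"
  proof (rule Bochner_Integration.integral_cong)
    fix \<omega> assume "\<omega> \<in> space M"
    from sum_B[OF this, of "\<lambda>_. 1 :: real"] B_card[OF this]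
    show "(\<Sum>i\<in>{1..N}. of_bool (i \<in> B \<omega>)) = real b" by simp
  qed simp
  also have "(1 / real b) * (expectation (\<lambda>_. real b) * C) = C"
    using b by (simp add: prob_space)
  finally show "expectation (\<lambda>\<omega>. (norm (avg \<omega>))\<^sup>2) \<le> C" .
qed

theorem proposition5p2:
  fixes M :: "'w measure" and S :: "'s measure"
    and \<xi> :: "nat \<Rightarrow> 'w \<Rightarrow> 's" and B :: "'w \<Rightarrow> nat set"
    and \<psi> :: "real ^ 'n \<Rightarrow> 's \<Rightarrow> real" and \<X> :: "(real ^ 'n) set"
    and \<phi> :: "real \<Rightarrow> real" and \<phi>t :: "real \<Rightarrow> real \<Rightarrow> real"
    and N b :: nat and G\<^sub>1 G\<^sub>2 :: real
  assumes "prob_space M"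
    and "1 \<le> N" and "1 \<le> b" and "b \<le> N"
    and "\<And>i. i \<in> {1..N} \<Longrightarrow> \<xi> i \<in> measurable M S"
    and "\<And>y. \<psi> y \<in> borel_measurable S"
    and "\<And>i \<omega> y. i \<in> {1..N} \<Longrightarrow> \<omega> \<in> space M \<Longrightarrow> (\<lambda>z. \<psi> z (\<xi> i \<omega>)) differentiable (at y)"
    and "locally_lipschitz \<phi>"
    and "smoothing_function \<phi>t \<phi>"
    and "uniform_batch M N b B"
    and "indep_rv M (count_space (batches N b)) B
           (PiM {1..N} (\<lambda>_. S)) (\<lambda>\<omega>. restrict (\<lambda>i. \<xi> i \<omega>) {1..N})"
    and "G\<^sub>1 > 0"
    and "\<And>x i. x \<in> \<X> \<Longrightarrow> i \<in> {1..N} \<Longrightarrow>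
           integrable M (\<lambda>\<omega>. (norm (grad (\<lambda>y. \<psi> y (\<xi> i \<omega>)) x))\<^sup>2) \<and>
           prob_space.expectation M (\<lambda>\<omega>. (norm (grad (\<lambda>y. \<psi> y (\<xi> i \<omega>)) x))\<^sup>2) \<le> G\<^sub>1\<^sup>2"
    and "G\<^sub>2 > 0"
    and "\<And>x \<mu> i. x \<in> \<X> \<Longrightarrow> \<mu> > 0 \<Longrightarrow> i \<in> {1..N} \<Longrightarrow>
           integrable M (\<lambda>\<omega>. (deriv (\<lambda>z. \<phi>t z \<mu>) (\<psi> x (\<xi> i \<omega>)))\<^sup>2) \<and>
           prob_space.expectation M (\<lambda>\<omega>. (deriv (\<lambda>z. \<phi>t z \<mu>) (\<psi> x (\<xi> i \<omega>)))\<^sup>2) \<le> (G\<^sub>2 / \<mu>)\<^sup>2"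
    and "\<And>x i. x \<in> \<X> \<Longrightarrow> i \<in> {1..N} \<Longrightarrow>
           indep_rv M borel (\<lambda>\<omega>. \<psi> x (\<xi> i \<omega>)) borel (\<lambda>\<omega>. grad (\<lambda>y. \<psi> y (\<xi> i \<omega>)) x)"
  shows "\<forall>x\<in>\<X>. \<forall>\<mu>>0.
           integrable M (\<lambda>\<omega>. (norm (batch_smoothing_gradient \<phi>t \<psi> (B \<omega>) (\<lambda>i. \<xi> i \<omega>) x \<mu>))\<^sup>2) \<and>
           prob_space.expectation M
             (\<lambda>\<omega>. (norm (batch_smoothing_gradient \<phi>t \<psi> (B \<omega>) (\<lambda>i. \<xi> i \<omega>) x \<mu>))\<^sup>2)
           \<le> (G\<^sub>1 * G\<^sub>2 / \<mu>)\<^sup>2"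
proof (intro ballI allI impI)
  fix x and \<mu> :: real assume x: "x \<in> \<X>" and \<mu>: "\<mu> > 0"
  interpret prob_space M by fact
  note \<xi>[measurable] = assms(5) and \<psi>[measurable] = assms(6)
  note diff = assms(7) and indB = assms(11) and G1 = assms(13) and G2 = assms(15) and ind4 = assms(16)
  have B: "B \<in> measurable M (count_space (batches N b))"
    using assms(10) by (simp add: uniform_batch_def)
  define d where "d = deriv (\<lambda>z. \<phi>t z \<mu>)"
  have d[measurable]: "d \<in> borel_measurable borel"
    unfolding d_def using assms(9) \<mu>
    by (intro borel_measurable_deriv_C1) (simp add: smoothing_function_def)
  obtain G where G[measurable]: "G \<in> borel_measurable S"
    and grad_G: "\<And>s. (\<lambda>y. \<psi> y s) differentiable (at x) \<Longrightarrow> grad (\<lambda>y. \<psi> y s) x = G s"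
    by (rule grad_factors_measurably[where \<psi> = \<psi> and S = S and x = x, OF \<psi>]) (rule that, assumption, simp)
  \<comment> \<open>\<open>V\<close> keeps the true gradient, about which hypotheses (2) and (4)
    speak; \<open>V_G\<close> switches to \<open>G\<close> where a measurable function of the sample
    is needed.\<close>
  define V where "V = (\<lambda>i \<omega>. d (\<psi> x (\<xi> i \<omega>)) *\<^sub>R grad (\<lambda>y. \<psi> y (\<xi> i \<omega>)) x)"
  have V_sq: "(norm (V i \<omega>))\<^sup>2 = (d (\<psi> x (\<xi> i \<omega>)))\<^sup>2 * (norm (grad (\<lambda>y. \<psi> y (\<xi> i \<omega>)) x))\<^sup>2" for i \<omega>
    by (simp add: V_def power_mult_distrib)
  have V_G: "V i \<omega> = d (\<psi> x (\<xi> i \<omega>)) *\<^sub>R G (\<xi> i \<omega>)" if "i \<in> {1..N}" "\<omega> \<in> space M" for i \<omega>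
    using grad_G[OF diff[OF that]] by (simp add: V_def)
  have V_meas: "V i \<in> borel_measurable M" if i: "i \<in> {1..N}" for i
  proof -
    have [measurable]: "\<xi> i \<in> measurable M S" using \<xi>[OF i] .
    have "(\<lambda>\<omega>. d (\<psi> x (\<xi> i \<omega>)) *\<^sub>R G (\<xi> i \<omega>)) \<in> borel_measurable M" by measurable
    then show ?thesis by (rule measurable_cong[THEN iffD1, rotated]) (simp add: V_G[OF i])
  qed
  \<comment> \<open>Squaring after \<open>d\<close> and squaring the norm are Borel maps of the two
    variables that hypothesis (4) makes independent.\<close>
  have ind_sq: "indep_var borel (\<lambda>\<omega>. (d (\<psi> x (\<xi> i \<omega>)))\<^sup>2)
      borel (\<lambda>\<omega>. (norm (grad (\<lambda>y. \<psi> y (\<xi> i \<omega>)) x))\<^sup>2)" if i: "i \<in> {1..N}" for i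
    unfolding indep_rv_iff_indep_var[symmetric]
    by (rule indep_rv_compose[OF prob_space_axioms ind4[OF x i], where f = "\<lambda>t. (d t)\<^sup>2" and g = "\<lambda>v. (norm v)\<^sup>2"])
       measurable
  have V_int: "integrable M (\<lambda>\<omega>. (norm (V i \<omega>))\<^sup>2)"
    and V_bound: "expectation (\<lambda>\<omega>. (norm (V i \<omega>))\<^sup>2) \<le> (G\<^sub>1 * G\<^sub>2 / \<mu>)\<^sup>2" if i: "i \<in> {1..N}" for i
  proof -
    note g1 = G1[OF x i] and g2 = G2[OF x \<mu> i, folded d_def]
    show "integrable M (\<lambda>\<omega>. (norm (V i \<omega>))\<^sup>2)"
      unfolding V_sq using ind_sq[OF i] g1 g2 by (intro indep_var_integrable) auto
    have "expectation (\<lambda>\<omega>. (norm (V i \<omega>))\<^sup>2) =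
        expectation (\<lambda>\<omega>. (d (\<psi> x (\<xi> i \<omega>)))\<^sup>2) * expectation (\<lambda>\<omega>. (norm (grad (\<lambda>y. \<psi> y (\<xi> i \<omega>)) x))\<^sup>2)"
      unfolding V_sq using ind_sq[OF i] g1 g2 by (intro indep_var_lebesgue_integral) auto
    also have "\<dots> \<le> (G\<^sub>2 / \<mu>)\<^sup>2 * G\<^sub>1\<^sup>2"
      using g1 g2 by (intro mult_mono) auto
    also have "\<dots> = (G\<^sub>1 * G\<^sub>2 / \<mu>)\<^sup>2" by (simp add: power_mult_distrib power_divide)
    finally show "expectation (\<lambda>\<omega>. (norm (V i \<omega>))\<^sup>2) \<le> (G\<^sub>1 * G\<^sub>2 / \<mu>)\<^sup>2" .
  qed
  have ind_B: "indep_var borel (\<lambda>\<omega>. of_bool (i \<in> B \<omega>) :: real) borel (\<lambda>\<omega>. (norm (V i \<omega>))\<^sup>2)"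
    if i: "i \<in> {1..N}" for i
  proof -
    have [measurable]: "(\<lambda>s. s i) \<in> measurable (PiM {1..N} (\<lambda>_. S)) S"
      using i by (rule measurable_component_singleton)
    \<comment> \<open>The batch is independent of the whole sample vector, hence of any measurable
      function of its coordinate \<open>i\<close>. Here \<open>G\<close> is essential, as the
      function must be measurable on the sample space.\<close>
    have "indep_rv M borel (\<lambda>\<omega>. of_bool (i \<in> B \<omega>) :: real)
        borel (\<lambda>\<omega>. (norm (d (\<psi> x (restrict (\<lambda>j. \<xi> j \<omega>) {1..N} i)) *\<^sub>R G (restrict (\<lambda>j. \<xi> j \<omega>) {1..N} i)))\<^sup>2)"
      by (rule indep_rv_compose[OF prob_space_axioms indB, where f = "\<lambda>A. of_bool (i \<in> A)"
            and g = "\<lambda>s. (norm (d (\<psi> x (s i)) *\<^sub>R G (s i)))\<^sup>2"]) measurable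
    \<comment> \<open>At outcomes in \<open>space M\<close> the sample makes \<psi> differentiable,
      so \<open>G\<close> can be replaced by the gradient again.\<close>
    then have "indep_rv M borel (\<lambda>\<omega>. of_bool (i \<in> B \<omega>) :: real) borel (\<lambda>\<omega>. (norm (V i \<omega>))\<^sup>2)"
      by (rule indep_rv_cong[THEN iffD1, rotated -1]) (use i in \<open>auto simp: V_G\<close>)
    then show ?thesis by (simp add: indep_rv_iff_indep_var)
  qed
  have eq: "batch_smoothing_gradient \<phi>t \<psi> (B \<omega>) (\<lambda>i. \<xi> i \<omega>) x \<mu> =
      (1 / real (card (B \<omega>))) *\<^sub>R (\<Sum>i\<in>B \<omega>. V i \<omega>)" for \<omega>
    by (simp add: batch_smoothing_gradient_def V_def d_def)
  show "integrable M (\<lambda>\<omega>. (norm (batch_smoothing_gradient \<phi>t \<psi> (B \<omega>) (\<lambda>i. \<xi> i \<omega>) x \<mu>))\<^sup>2) \<and>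
      expectation (\<lambda>\<omega>. (norm (batch_smoothing_gradient \<phi>t \<psi> (B \<omega>) (\<lambda>i. \<xi> i \<omega>) x \<mu>))\<^sup>2)
      \<le> (G\<^sub>1 * G\<^sub>2 / \<mu>)\<^sup>2"
    unfolding eq
    by (intro conjI batch_average_second_moment[OF assms(3) B V_meas V_int V_bound ind_B])
qed

end
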